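(* Let $R\neq 0$ be a left-symmetric conformal algebra, let $Q$ be a $\mathbb{C}[\partial]$-module, and let $E=R\oplus Q$ (direct sum of $\mathbb{C}[\partial]$-modules). (i) Set $\mathcal{H}^2_R(Q,R):=\mathfrak{L}(R,Q)/\equiv$. Then the map $$\mathcal{H}^2_R(Q,R)\to CExtd(E,R),\qquad \overline{\Omega(R,Q)}\mapsto (R\natural Q,\ \cdot_\lambda\cdot)$$ (sending the class of $\Omega(R,Q)$ under $\equiv$ to the $\equiv$-class of the unified product of $R$ and $\Omega(R,Q)$) is bijective. (ii) Set $\mathcal{H}^2(Q,R):=\mathfrak{L}(R,Q)/\approx$. Then the map $$\mathcal{H}^2(Q,R)\to CExtd'(E,R),\qquad \overline{\overline{\Omega(R,Q)}}\mapsto (R\natural Q,\ \cdot_\lambda\cdot)$$ (sending the class of $\Omega(R,Q)$ under $\approx$ to the $\approx$-class of the unified product of $R$ and $\Omega(R,Q)$) is bijective.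
   Context: All vector spaces are over $\mathbb{C}$; $V[\lambda]$ is the space of polynomials in $\lambda$ with coefficients in $V$. A left-symmetric conformal algebra is a $\mathbb{C}[\partial]$-module $R$ with a $\mathbb{C}$-bilinear map ($\lambda$-product) $R\times R\to R[\lambda]$, $(a,b)\mapsto a_\lambda b$, such that for all $a,b,c\in R$: $(\partial a)_\lambda b=-\lambda\, a_\lambda b$, $a_\lambda(\partial b)=(\partial+\lambda)a_\lambda b$, and $(a_\lambda b)_{\lambda+\mu}c-a_\lambda(b_\mu c)=(b_\mu a)_{\lambda+\mu}c-b_\mu(a_\lambda c)$. Homomorphisms are $\mathbb{C}[\partial]$-module maps preserving $\lambda$-products. For $\mathbb{C}[\partial]$-modules $U,V,W$: a conformal linear map $U\to V$ is a $\mathbb{C}$-linear map $\psi_\lambda:U\to V[\lambda]$ with $\psi_\lambda(\partial a)=(\partial+\lambda)\psi_\lambda a$; a conformal bilinear map $U\times V\to W$ is a $\mathbb{C}$-bilinear map $f_\lambda(\cdot,\cdot):U\times V\to W[\lambda]$ with $f_\lambda(\partial a,b)=-\lambda f_\lambda(a,b)$, $f_\lambda(a,\partial b)=(\lambda+\partial)f_\lambda(a,b)$. $Cend(V)$ is the space of conformal linear maps $V\to V$, a $\mathbb{C}[\partial]$-module via $(\partial\varphi)_\lambda=-\lambda\varphi_\lambda$. Conventions: all maps are extended linearly to coefficients polynomial in the formal variables; if $f_\nu=\sum_i\nu^i f_i$, then $f_{-\lambda-\partial}v=\sum_i(-\lambda-\partial)^i f_i(v)$, with $\partial$ acting from the left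 on the resulting element. An extending datum of $R$ by $Q$ is a system $\Omega(R,Q)=(\varphi,\psi,l,r,g_\lambda(\cdot,\cdot),\circ_\lambda)$ of $\mathbb{C}[\partial]$-module homomorphisms $l,r:R\to Cend(Q)$, $\varphi,\psi:Q\to Cend(R)$ and conformal bilinear maps $g_\lambda:Q\times Q\to R[\lambda]$, $\circ_\lambda:Q\times Q\to Q[\lambda]$. Given such a datum, $R\natural Q$ denotes the $\mathbb{C}[\partial]$-module $R\oplus Q$ with $$(a+x)_\lambda(b+y)=\big(a_\lambda b+\varphi(x)_\lambda b+\psi(y)_{-\lambda-\partial}a+g_\lambda(x,y)\big)+\big(x\circ_\lambda y+l(a)_\lambda y+r(b)_{-\lambda-\partial}x\big),$$ $a,b\in R$, $x,y\in Q$. If this is a left-symmetric conformal algebra, $R\natural Q$ is called the unified product of $R$ and $\Omega(R,Q)$, and $\Omega(R,Q)$ is called a left-symmetric conformal extending structure of $R$ by $Q$. $\mathfrak{L}(R,Q)$ is the set of all such extending structures. Equivalence of extending structures: $\Omega(R,Q)\equiv\Omega'(R,Q)$, where $\Omega'(R,Q)=(\varphi',\psi',l',r',g'_\lambda,\circ'_\lambda)$, if there are a $\mathbb{C}[\partial]$-module homomorphism $u:Q\to R$ and $v\in Aut_{\mathbb{C}[\partial]}(Q)$ such that for all $a\in R$, $x,y\in Q$: $\psi(x)_{-\lambda-\partial}a+u(l(a)_\lambda x)=a_\lambda u(x)+\psi'(v(x))_{-\lambda-\partial}a$; $v(l(a)_\lambda x)=l'(a)_\lambda v(x)$; $\varphi(x)_\lambda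 a+u(r(a)_{-\lambda-\partial}x)=u(x)_\lambda a+\varphi'(v(x))_\lambda a$; $v(r(a)_{-\lambda-\partial}x)=r'(a)_{-\lambda-\partial}v(x)$; $g_\lambda(x,y)+u(x\circ_\lambda y)=u(x)_\lambda u(y)+\varphi'(v(x))_\lambda u(y)+\psi'(v(y))_{-\lambda-\partial}u(x)+g'_\lambda(v(x),v(y))$; $v(x\circ_\lambda y)=r'(u(y))_{-\lambda-\partial}v(x)+l'(u(x))_\lambda v(y)+v(x)\circ'_\lambda v(y)$. If this holds with $v=\mathrm{Id}_Q$, write $\Omega(R,Q)\approx\Omega'(R,Q)$. Equivalence of algebra structures: let $i:R\to E$ be the inclusion and $\pi:E\to Q$ the canonical projection. A $\mathbb{C}[\partial]$-module homomorphism $\phi:E\to E$ stabilizes $R$ if $\phi\circ i=i$, and co-stabilizes $Q$ if $\pi\circ\phi=\pi$. Two left-symmetric conformal algebra structures on $E$, both containing $R$ (with its given $\lambda$-product) as a subalgebra, are related by $\equiv$ if there is an isomorphism between them stabilizing $R$, and by $\approx$ if there is an isomorphism between them stabilizing $R$ and co-stabilizing $Q$. $CExtd(E,R)$ and $CExtd'(E,R)$ are the sets of equivalence classes, under $\equiv$ and $\approx$ respectively, of left-symmetric conformal algebra structures on $E$ containing $R$ as a subalgebra. *)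

theory Defs
  imports
    Complex_Main
    "HOL-Computational_Algebra.Polynomial"
    "HOL-Library.Product_Plus"
    "HOL-Library.Function_Algebras"
begin

text \<open>
  A \<open>\<complex>[\<partial>]\<close>-module is a module over the ring \<^typ>\<open>complex poly\<close>, given by its scalar
  multiplication \<open>s\<close> (locale \<^locale>\<open>module\<close>); homomorphisms are \<^const>\<open>module_hom\<close>.
  The space \<open>V[\<lambda>]\<close> is the type \<open>'v poly\<close>, where multiplication by \<open>\<lambda>\<close> is \<open>pCons 0\<close>.
\<close>

definition cscale :: "(complex poly \<Rightarrow> 'v \<Rightarrow> 'v) \<Rightarrow> complex \<Rightarrow> 'v \<Rightarrow> 'v" where
  "cscale s c = s [:c:]"

definition der :: "(complex poly \<Rightarrow> 'v \<Rightarrow> 'v) \<Rightarrow> 'v \<Rightarrow> 'v" where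
  "der s = s [:0, 1:]"

text \<open>The coefficientwise \<open>\<complex>[\<partial>]\<close>-module structure on \<open>V[\<lambda>]\<close>.\<close>

definition pscale ::
    "(complex poly \<Rightarrow> 'v \<Rightarrow> 'v) \<Rightarrow> complex poly \<Rightarrow> 'v::ab_group_add poly \<Rightarrow> 'v poly" where
  "pscale s p = map_poly (s p)"

text \<open>
  For \<open>p = (\<Sum>i. \<nu>\<^sup>i v\<^sub>i)\<close>, \<open>poly_subst X h p\<close> is \<open>\<Sum>i. X\<^sup>i (h v\<^sub>i)\<close>: the map \<open>h\<close> is extended
  linearly to coefficients polynomial in \<open>\<nu>\<close>, and \<open>\<nu>\<close> is replaced by the operator \<open>X\<close>.
\<close>

definition poly_subst ::
    "('w \<Rightarrow> 'w) \<Rightarrow> ('v \<Rightarrow> 'w) \<Rightarrow> 'v::zero poly \<Rightarrow> 'w::comm_monoid_add" where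
  "poly_subst X h p = (\<Sum>i\<le>degree p. (X ^^ i) (h (coeff p i)))"

text \<open>If \<open>p = f\<^sub>\<lambda> v\<close>, then \<open>flip_var s p\<close> is \<open>f\<close> at \<open>-\<lambda>-\<partial>\<close> applied to \<open>v\<close>.\<close>

definition flip_var ::
    "(complex poly \<Rightarrow> 'v \<Rightarrow> 'v) \<Rightarrow> 'v::ab_group_add poly \<Rightarrow> 'v poly" where
  "flip_var s p = poly_subst (\<lambda>q. - pCons 0 q - der (pscale s) q) (\<lambda>v. [:v:]) p"

definition conf_linear ::
    "(complex poly \<Rightarrow> 'u::ab_group_add \<Rightarrow> 'u) \<Rightarrow> (complex poly \<Rightarrow> 'v::ab_group_add \<Rightarrow> 'v)
      \<Rightarrow> ('u \<Rightarrow> 'v poly) \<Rightarrow> bool" where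
  "conf_linear sU sV f \<longleftrightarrow>
     Vector_Spaces.linear (cscale sU) (cscale (pscale sV)) f \<and>
     (\<forall>a. f (der sU a) = der (pscale sV) (f a) + pCons 0 (f a))"

definition conf_bilinear ::
    "(complex poly \<Rightarrow> 'u::ab_group_add \<Rightarrow> 'u) \<Rightarrow> (complex poly \<Rightarrow> 'v::ab_group_add \<Rightarrow> 'v)
      \<Rightarrow> (complex poly \<Rightarrow> 'w::ab_group_add \<Rightarrow> 'w) \<Rightarrow> ('u \<Rightarrow> 'v \<Rightarrow> 'w poly) \<Rightarrow> bool" where
  "conf_bilinear sU sV sW f \<longleftrightarrow>
     (\<forall>b. Vector_Spaces.linear (cscale sU) (cscale (pscale sW)) (\<lambda>a. f a b)) \<and>
     (\<forall>a. Vector_Spaces.linear (cscale sV) (cscale (pscale sW)) (f a)) \<and>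
     (\<forall>a b. f (der sU a) b = - pCons 0 (f a b)) \<and>
     (\<forall>a b. f a (der sV b) = pCons 0 (f a b) + der (pscale sW) (f a b))"

definition Cend :: "(complex poly \<Rightarrow> 'v::ab_group_add \<Rightarrow> 'v) \<Rightarrow> ('v \<Rightarrow> 'v poly) set" where
  "Cend s = {f. conf_linear s s f}"

text \<open>
  The action \<open>(\<partial>f)\<^sub>\<lambda> = -\<lambda> f\<^sub>\<lambda>\<close>, that is, \<open>p(\<partial>)\<close> acts as \<open>p(-\<lambda>)\<close>. It is defined on all
  functions \<open>V \<rightarrow> V[\<lambda>]\<close>; \<^const>\<open>Cend\<close> is a submodule.
\<close>

definition cend_scale ::
    "(complex poly \<Rightarrow> 'v \<Rightarrow> 'v) \<Rightarrow> complex poly \<Rightarrow> ('v \<Rightarrow> 'v poly) \<Rightarrow> 'v \<Rightarrow> 'v::ab_group_add poly"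
  where
  "cend_scale s p f =
     (\<lambda>v. poly_subst (\<lambda>q. - pCons 0 q) (\<lambda>c. cscale (pscale s) c (f v)) p)"

definition hom_to_Cend ::
    "(complex poly \<Rightarrow> 'u::ab_group_add \<Rightarrow> 'u) \<Rightarrow> (complex poly \<Rightarrow> 'v::ab_group_add \<Rightarrow> 'v)
      \<Rightarrow> ('u \<Rightarrow> 'v \<Rightarrow> 'v poly) \<Rightarrow> bool" where
  "hom_to_Cend sU sV F \<longleftrightarrow> module_hom sU (cend_scale sV) F \<and> range F \<subseteq> Cend sV"

text \<open>
  \<open>V[\<lambda>,\<mu>]\<close> is \<open>'v poly poly\<close> with inner variable \<open>\<lambda>\<close> and outer variable \<open>\<mu>\<close>;
  \<open>at_var X p\<close> is \<open>p \<in> V[\<nu>]\<close> with \<open>\<nu>\<close> replaced by \<open>X\<close>, where \<open>X\<close> is multiplication by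
  \<open>\<lambda>\<close>, \<open>\<mu>\<close> or \<open>\<lambda> + \<mu>\<close>.
\<close>

definition mult_lam :: "'v::ab_group_add poly poly \<Rightarrow> 'v poly poly" where
  "mult_lam = map_poly (pCons 0)"

definition mult_mu :: "'v::ab_group_add poly poly \<Rightarrow> 'v poly poly" where
  "mult_mu = pCons 0"

definition mult_lam_mu :: "'v::ab_group_add poly poly \<Rightarrow> 'v poly poly" where
  "mult_lam_mu q = mult_lam q + mult_mu q"

definition at_var ::
    "('v poly poly \<Rightarrow> 'v poly poly) \<Rightarrow> 'v::ab_group_add poly \<Rightarrow> 'v poly poly" where
  "at_var X p = poly_subst X (\<lambda>v. [:[:v:]:]) p"

text \<open>
  In the last clause the four terms are \<open>(a\<^sub>\<lambda> b)\<^bsub>\<lambda>+\<mu>\<^esub> c\<close>, \<open>a\<^sub>\<lambda> (b\<^sub>\<mu> c)\<close>, \<open>(b\<^sub>\<mu> a)\<^bsub>\<lambda>+\<mu>\<^esub> c\<close>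
  and \<open>b\<^sub>\<mu> (a\<^sub>\<lambda> c)\<close>.
\<close>

definition left_symm_conf_alg ::
    "(complex poly \<Rightarrow> 'v::ab_group_add \<Rightarrow> 'v) \<Rightarrow> ('v \<Rightarrow> 'v \<Rightarrow> 'v poly) \<Rightarrow> bool" where
  "left_symm_conf_alg s m \<longleftrightarrow>
     module s \<and> conf_bilinear s s s m \<and>
     (\<forall>a b c.
        poly_subst mult_lam (\<lambda>d. at_var mult_lam_mu (m d c)) (m a b)
          - poly_subst mult_mu (\<lambda>d. at_var mult_lam (m a d)) (m b c)
      = poly_subst mult_mu (\<lambda>d. at_var mult_lam_mu (m d c)) (m b a)
          - poly_subst mult_lam (\<lambda>d. at_var mult_mu (m b d)) (m a c))"

definition lsca_hom ::
    "(complex poly \<Rightarrow> 'v::ab_group_add \<Rightarrow> 'v) \<Rightarrow> ('v \<Rightarrow> 'v \<Rightarrow> 'v poly) \<Rightarrow>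
     (complex poly \<Rightarrow> 'w::ab_group_add \<Rightarrow> 'w) \<Rightarrow> ('w \<Rightarrow> 'w \<Rightarrow> 'w poly) \<Rightarrow> ('v \<Rightarrow> 'w) \<Rightarrow> bool" where
  "lsca_hom s m s' m' f \<longleftrightarrow>
     module_hom s s' f \<and> (\<forall>a b. map_poly f (m a b) = m' (f a) (f b))"

definition lsca_iso ::
    "(complex poly \<Rightarrow> 'v::ab_group_add \<Rightarrow> 'v) \<Rightarrow> ('v \<Rightarrow> 'v \<Rightarrow> 'v poly) \<Rightarrow>
     (complex poly \<Rightarrow> 'w::ab_group_add \<Rightarrow> 'w) \<Rightarrow> ('w \<Rightarrow> 'w \<Rightarrow> 'w poly) \<Rightarrow> ('v \<Rightarrow> 'w) \<Rightarrow> bool" where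
  "lsca_iso s m s' m' f \<longleftrightarrow> lsca_hom s m s' m' f \<and> bij f"

record (overloaded) ('r, 'q) ext_datum =
  phi :: "'q \<Rightarrow> 'r \<Rightarrow> 'r poly"
  psi :: "'q \<Rightarrow> 'r \<Rightarrow> 'r poly"
  lact :: "'r \<Rightarrow> 'q \<Rightarrow> 'q poly"
  ract :: "'r \<Rightarrow> 'q \<Rightarrow> 'q poly"
  gmap :: "'q \<Rightarrow> 'q \<Rightarrow> 'r poly"
  circ :: "'q \<Rightarrow> 'q \<Rightarrow> 'q poly"

definition extending_datum ::
    "(complex poly \<Rightarrow> 'r::ab_group_add \<Rightarrow> 'r) \<Rightarrow> (complex poly \<Rightarrow> 'q::ab_group_add \<Rightarrow> 'q)
      \<Rightarrow> ('r, 'q) ext_datum \<Rightarrow> bool" where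
  "extending_datum sR sQ \<Omega> \<longleftrightarrow>
     hom_to_Cend sQ sR (phi \<Omega>) \<and> hom_to_Cend sQ sR (psi \<Omega>) \<and>
     hom_to_Cend sR sQ (lact \<Omega>) \<and> hom_to_Cend sR sQ (ract \<Omega>) \<and>
     conf_bilinear sQ sQ sR (gmap \<Omega>) \<and> conf_bilinear sQ sQ sQ (circ \<Omega>)"

text \<open>\<open>E = R \<oplus> Q\<close> is the product type; \<open>R\<close> and \<open>Q\<close> are embedded by \<open>a \<mapsto> (a, 0)\<close>, \<open>x \<mapsto> (0, x)\<close>.\<close>

definition sum_scale ::
    "(complex poly \<Rightarrow> 'r \<Rightarrow> 'r) \<Rightarrow> (complex poly \<Rightarrow> 'q \<Rightarrow> 'q)
      \<Rightarrow> complex poly \<Rightarrow> 'r \<times> 'q \<Rightarrow> 'r \<times> 'q" where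
  "sum_scale sR sQ p = (\<lambda>(a, x). (sR p a, sQ p x))"

definition unified_prod ::
    "(complex poly \<Rightarrow> 'r::ab_group_add \<Rightarrow> 'r) \<Rightarrow> (complex poly \<Rightarrow> 'q::ab_group_add \<Rightarrow> 'q)
      \<Rightarrow> ('r \<Rightarrow> 'r \<Rightarrow> 'r poly) \<Rightarrow> ('r, 'q) ext_datum
      \<Rightarrow> 'r \<times> 'q \<Rightarrow> 'r \<times> 'q \<Rightarrow> ('r \<times> 'q) poly" where
  "unified_prod sR sQ mR \<Omega> = (\<lambda>(a, x) (b, y).
     map_poly (\<lambda>c. (c, 0))
       (mR a b + phi \<Omega> x b + flip_var sR (psi \<Omega> y a) + gmap \<Omega> x y) +
     map_poly (\<lambda>z. (0, z))
       (circ \<Omega> x y + lact \<Omega> a y + flip_var sQ (ract \<Omega> b x)))"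

definition extending_structures ::
    "(complex poly \<Rightarrow> 'r::ab_group_add \<Rightarrow> 'r) \<Rightarrow> (complex poly \<Rightarrow> 'q::ab_group_add \<Rightarrow> 'q)
      \<Rightarrow> ('r \<Rightarrow> 'r \<Rightarrow> 'r poly) \<Rightarrow> ('r, 'q) ext_datum set" where
  "extending_structures sR sQ mR =
     {\<Omega>. extending_datum sR sQ \<Omega> \<and>
         left_symm_conf_alg (sum_scale sR sQ) (unified_prod sR sQ mR \<Omega>)}"

definition ext_compatible ::
    "(complex poly \<Rightarrow> 'r::ab_group_add \<Rightarrow> 'r) \<Rightarrow> (complex poly \<Rightarrow> 'q::ab_group_add \<Rightarrow> 'q)
      \<Rightarrow> ('r \<Rightarrow> 'r \<Rightarrow> 'r poly) \<Rightarrow> ('r, 'q) ext_datum \<Rightarrow> ('r, 'q) ext_datum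
      \<Rightarrow> ('q \<Rightarrow> 'r) \<Rightarrow> ('q \<Rightarrow> 'q) \<Rightarrow> bool" where
  "ext_compatible sR sQ mR \<Omega> \<Omega>' u v \<longleftrightarrow>
     (\<forall>a x. flip_var sR (psi \<Omega> x a) + map_poly u (lact \<Omega> a x)
            = mR a (u x) + flip_var sR (psi \<Omega>' (v x) a)) \<and>
     (\<forall>a x. map_poly v (lact \<Omega> a x) = lact \<Omega>' a (v x)) \<and>
     (\<forall>a x. phi \<Omega> x a + map_poly u (flip_var sQ (ract \<Omega> a x))
            = mR (u x) a + phi \<Omega>' (v x) a) \<and>
     (\<forall>a x. map_poly v (flip_var sQ (ract \<Omega> a x)) = flip_var sQ (ract \<Omega>' a (v x))) \<and>
     (\<forall>x y. gmap \<Omega> x y + map_poly u (circ \<Omega> x y)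
            = mR (u x) (u y) + phi \<Omega>' (v x) (u y) + flip_var sR (psi \<Omega>' (v y) (u x))
              + gmap \<Omega>' (v x) (v y)) \<and>
     (\<forall>x y. map_poly v (circ \<Omega> x y)
            = flip_var sQ (ract \<Omega>' (u y) (v x)) + lact \<Omega>' (u x) (v y)
              + circ \<Omega>' (v x) (v y))"

definition ext_equiv ::
    "(complex poly \<Rightarrow> 'r::ab_group_add \<Rightarrow> 'r) \<Rightarrow> (complex poly \<Rightarrow> 'q::ab_group_add \<Rightarrow> 'q)
      \<Rightarrow> ('r \<Rightarrow> 'r \<Rightarrow> 'r poly) \<Rightarrow> ('r, 'q) ext_datum rel" where
  "ext_equiv sR sQ mR =
     {(\<Omega>, \<Omega>'). \<Omega> \<in> extending_structures sR sQ mR \<and> \<Omega>' \<in> extending_structures sR sQ mR \<and>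
       (\<exists>u v. module_hom sQ sR u \<and> module_hom sQ sQ v \<and> bij v \<and>
              ext_compatible sR sQ mR \<Omega> \<Omega>' u v)}"

definition ext_equiv_id ::
    "(complex poly \<Rightarrow> 'r::ab_group_add \<Rightarrow> 'r) \<Rightarrow> (complex poly \<Rightarrow> 'q::ab_group_add \<Rightarrow> 'q)
      \<Rightarrow> ('r \<Rightarrow> 'r \<Rightarrow> 'r poly) \<Rightarrow> ('r, 'q) ext_datum rel" where
  "ext_equiv_id sR sQ mR =
     {(\<Omega>, \<Omega>'). \<Omega> \<in> extending_structures sR sQ mR \<and> \<Omega>' \<in> extending_structures sR sQ mR \<and>
       (\<exists>u. module_hom sQ sR u \<and> ext_compatible sR sQ mR \<Omega> \<Omega>' u id)}"

definition alg_structures ::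
    "(complex poly \<Rightarrow> 'r::ab_group_add \<Rightarrow> 'r) \<Rightarrow> (complex poly \<Rightarrow> 'q::ab_group_add \<Rightarrow> 'q)
      \<Rightarrow> ('r \<Rightarrow> 'r \<Rightarrow> 'r poly) \<Rightarrow> ('r \<times> 'q \<Rightarrow> 'r \<times> 'q \<Rightarrow> ('r \<times> 'q) poly) set" where
  "alg_structures sR sQ mR =
     {m. left_symm_conf_alg (sum_scale sR sQ) m \<and>
         (\<forall>a b. m (a, 0) (b, 0) = map_poly (\<lambda>c. (c, 0)) (mR a b))}"

definition stabilizes :: "('r \<times> 'q::zero \<Rightarrow> 'r \<times> 'q) \<Rightarrow> bool" where
  "stabilizes f \<longleftrightarrow> (\<forall>a. f (a, 0) = (a, 0))"

definition co_stabilizes :: "('r \<times> 'q \<Rightarrow> 'r \<times> 'q) \<Rightarrow> bool" where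
  "co_stabilizes f \<longleftrightarrow> snd \<circ> f = snd"

definition alg_equiv ::
    "(complex poly \<Rightarrow> 'r::ab_group_add \<Rightarrow> 'r) \<Rightarrow> (complex poly \<Rightarrow> 'q::ab_group_add \<Rightarrow> 'q)
      \<Rightarrow> ('r \<Rightarrow> 'r \<Rightarrow> 'r poly) \<Rightarrow> ('r \<times> 'q \<Rightarrow> 'r \<times> 'q \<Rightarrow> ('r \<times> 'q) poly) rel" where
  "alg_equiv sR sQ mR =
     {(m, m'). m \<in> alg_structures sR sQ mR \<and> m' \<in> alg_structures sR sQ mR \<and>
       (\<exists>f. lsca_iso (sum_scale sR sQ) m (sum_scale sR sQ) m' f \<and> stabilizes f)}"

definition alg_equiv_co ::
    "(complex poly \<Rightarrow> 'r::ab_group_add \<Rightarrow> 'r) \<Rightarrow> (complex poly \<Rightarrow> 'q::ab_group_add \<Rightarrow> 'q)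
      \<Rightarrow> ('r \<Rightarrow> 'r \<Rightarrow> 'r poly) \<Rightarrow> ('r \<times> 'q \<Rightarrow> 'r \<times> 'q \<Rightarrow> ('r \<times> 'q) poly) rel" where
  "alg_equiv_co sR sQ mR =
     {(m, m'). m \<in> alg_structures sR sQ mR \<and> m' \<in> alg_structures sR sQ mR \<and>
       (\<exists>f. lsca_iso (sum_scale sR sQ) m (sum_scale sR sQ) m' f \<and>
            stabilizes f \<and> co_stabilizes f)}"

text \<open>The quotients \<open>\<H>\<^sup>2\<^sub>R(Q, R)\<close>, \<open>\<H>\<^sup>2(Q, R)\<close>, \<open>CExtd(E, R)\<close> and \<open>CExtd'(E, R)\<close>.\<close>

definition H2_R ::
    "(complex poly \<Rightarrow> 'r::ab_group_add \<Rightarrow> 'r) \<Rightarrow> (complex poly \<Rightarrow> 'q::ab_group_add \<Rightarrow> 'q)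
      \<Rightarrow> ('r \<Rightarrow> 'r \<Rightarrow> 'r poly) \<Rightarrow> ('r, 'q) ext_datum set set" where
  "H2_R sR sQ mR = extending_structures sR sQ mR // ext_equiv sR sQ mR"

definition H2 ::
    "(complex poly \<Rightarrow> 'r::ab_group_add \<Rightarrow> 'r) \<Rightarrow> (complex poly \<Rightarrow> 'q::ab_group_add \<Rightarrow> 'q)
      \<Rightarrow> ('r \<Rightarrow> 'r \<Rightarrow> 'r poly) \<Rightarrow> ('r, 'q) ext_datum set set" where
  "H2 sR sQ mR = extending_structures sR sQ mR // ext_equiv_id sR sQ mR"

definition CExtd ::
    "(complex poly \<Rightarrow> 'r::ab_group_add \<Rightarrow> 'r) \<Rightarrow> (complex poly \<Rightarrow> 'q::ab_group_add \<Rightarrow> 'q)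
      \<Rightarrow> ('r \<Rightarrow> 'r \<Rightarrow> 'r poly) \<Rightarrow> ('r \<times> 'q \<Rightarrow> 'r \<times> 'q \<Rightarrow> ('r \<times> 'q) poly) set set" where
  "CExtd sR sQ mR = alg_structures sR sQ mR // alg_equiv sR sQ mR"

definition CExtd' ::
    "(complex poly \<Rightarrow> 'r::ab_group_add \<Rightarrow> 'r) \<Rightarrow> (complex poly \<Rightarrow> 'q::ab_group_add \<Rightarrow> 'q)
      \<Rightarrow> ('r \<Rightarrow> 'r \<Rightarrow> 'r poly) \<Rightarrow> ('r \<times> 'q \<Rightarrow> 'r \<times> 'q \<Rightarrow> ('r \<times> 'q) poly) set set" where
  "CExtd' sR sQ mR = alg_structures sR sQ mR // alg_equiv_co sR sQ mR"

end

theory Submission imports Defs begin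

text \<open>
  Fix the direct sum \<open>E = R \<oplus> Q\<close>. A conformal bilinear product on \<open>E\<close> is determined by its values on
  the four blocks \<open>R \<times> R\<close>, \<open>R \<times> Q\<close>, \<open>Q \<times> R\<close> and \<open>Q \<times> Q\<close>, each with one component in \<open>R\<close> and one in
  \<open>Q\<close>. If \<open>R\<close> is a subalgebra, the first block carries no information, and the six remaining
  components are an extending datum, up to the substitution of \<open>-\<lambda>-\<partial>\<close> for \<open>\<lambda>\<close> in two of them. This
  substitution is an involution that exchanges the two sesquilinearity rules
  (\<open>flip_var_flip_var\<close>, \<open>conf_bilinear_flip_var\<close>), and a homomorphism \<open>U \<rightarrow> Cend(V)\<close> is the same thing
  as a conformal bilinear map \<open>U \<times> V \<rightarrow> V\<close> (\<open>hom_to_Cend_iff_conf_bilinear\<close>); hence the components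
  of a conformal bilinear product do form an extending datum. So the unified product maps
  \<open>\<LL>(R, Q)\<close> onto the set of algebra structures that contain \<open>R\<close>
  (\<open>unified_prod_image\<close>): the identity of left symmetry never has to be expanded in components.

  It remains to compare the relations. A module endomorphism of \<open>E\<close> that fixes \<open>R\<close> pointwise is a shear
  \<open>(a, x) \<mapsto> (a + u x, v x)\<close>; it is bijective iff \<open>v\<close> is, and it co-stabilizes \<open>Q\<close> iff \<open>v = id\<close>.
  Comparing both sides of the homomorphism condition block by block gives nothing on \<open>R \<times> R\<close> and
  exactly two of the six compatibility equations on each of the other blocks
  (\<open>shear_hom_iff_compatible\<close>). Thus two extending structures are equivalent iff their unified
  products are (\<open>ext_equiv_iff_alg_equiv\<close>). A surjection that preserves and reflects relations transports
  the equivalence relation back and induces a bijection of the quotients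
  (\<open>bij_betw_quotients\<close>); this is applied once for \<open>\<equiv>\<close> and once for \<open>\<approx>\<close>.
\<close>

section \<open>Polynomials with coefficients in a module\<close>

lemma map_poly_add:
  assumes "additive f"
  shows "map_poly f (p + q) = map_poly f p + map_poly f q"
  by (intro poly_eqI) (simp add: coeff_map_poly additive.zero[OF assms] additive.add[OF assms])

lemma module_hom_additive: "module_hom s s' f \<Longrightarrow> additive f"
  by (simp add: additive_def module_hom_iff)

lemma map_poly_pscale:
  assumes "module_hom s s' f"
  shows "map_poly f (pscale s c p) = pscale s' c (map_poly f p)"
proof -
  interpret f: module_hom s s' f by (fact assms)
  show ?thesis
    by (intro poly_eqI) (simp add: pscale_def coeff_map_poly f.scale)
qed

lemma map_poly_shift: "f 0 = 0 \<Longrightarrow> map_poly f (pCons 0 p) = pCons 0 (map_poly f p)"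
  by (simp add: map_poly_pCons)

lemma module_pscale:
  assumes "module s"
  shows "module (pscale s)"
proof -
  interpret s: module s by (fact assms)
  show ?thesis
    by unfold_locales
      (intro poly_eqI;
        simp add: pscale_def coeff_map_poly s.scale_right_distrib s.scale_left_distrib)+
qed

lemma pscale_pCons:
  assumes "module s"
  shows "pscale s c (pCons a p) = pCons (s c a) (pscale s c p)"
  using module.scale_zero_right[OF assms] by (simp add: pscale_def map_poly_pCons)

lemma vector_space_cscale:
  assumes "module s"
  shows "vector_space (cscale s)"
proof -
  interpret s: module s by (fact assms)
  have "[:c + d:] = [:c:] + [:d:]" "[:c * d:] = [:c:] * [:d:]" "[:1 :: complex:] = 1" for c d :: complex
    by (simp_all add: one_pCons)
  then show ?thesis
    by unfold_locales (simp_all only: cscale_def s.scale_right_distrib s.scale_left_distrib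
        s.scale_scale s.scale_one)
qed

lemma poly_subst_pCons:
  fixes X :: "'w \<Rightarrow> 'w::ab_group_add"
  assumes X: "additive X" and h: "h 0 = 0"
  shows "poly_subst X h (pCons a p) = h a + X (poly_subst X h p)"
proof (cases "p = 0")
  case True
  then show ?thesis
    by (simp add: poly_subst_def h additive.zero[OF X])
next
  case False
  then show ?thesis
    by (simp add: poly_subst_def sum.atMost_Suc_shift additive.sum[OF X] del: sum.atMost_Suc)
qed

lemma poly_subst_0: "h 0 = 0 \<Longrightarrow> poly_subst X h 0 = 0"
  by (simp add: poly_subst_def)

section \<open>Substituting \<open>-\<lambda>-\<partial>\<close> for \<open>\<lambda>\<close>\<close>

lemma flip_var_0: "flip_var s 0 = 0"
  by (simp add: flip_var_def poly_subst_0)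

text \<open>
  Horner's rule for the substitution. Together with additivity it replaces the defining sum of
  operator powers by inductions on the polynomial.
\<close>

lemma flip_var_pCons:
  assumes "module s"
  shows "flip_var s (pCons a p) = [:a:] - pCons 0 (flip_var s p) - der (pscale s) (flip_var s p)"
proof -
  interpret P: module "pscale s" by (rule module_pscale[OF assms])
  have "additive (\<lambda>q. - pCons 0 q - der (pscale s) q)"
    by (simp add: additive_def der_def P.scale_right_distrib)
  from poly_subst_pCons[OF this, of "\<lambda>v. [:v:]" a p] show ?thesis
    by (simp add: flip_var_def)
qed

lemma flip_var_const: "module s \<Longrightarrow> flip_var s [:a:] = [:a:]"
  using module.scale_zero_right[OF module_pscale] by (simp add: flip_var_pCons flip_var_0 der_def)

lemma flip_var_add:
  assumes "module s"
  shows "flip_var s (p + q) = flip_var s p + flip_var s q"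
proof -
  interpret P: module "pscale s" by (rule module_pscale[OF assms])
  have "[:a + b:] - pCons 0 (P + Q) - der (pscale s) (P + Q) =
      ([:a:] - pCons 0 P - der (pscale s) P) + ([:b:] - pCons 0 Q - der (pscale s) Q)"
    for a b :: 'a and P Q :: "'a poly"
    by (intro poly_eqI)
      (simp add: der_def P.scale_right_distrib coeff_pCons split: nat.split)
  then show ?thesis
    by (induction p q rule: poly_induct2)
      (simp_all only: flip_var_0 flip_var_pCons[OF assms] add_pCons add_0_right)
qed

lemma flip_var_pscale:
  assumes "module s"
  shows "flip_var s (pscale s c p) = pscale s c (flip_var s p)"
proof -
  interpret P: module "pscale s" by (rule module_pscale[OF assms])
  show ?thesis
  proof (induction p)
    case 0
    then show ?case by (simp add: flip_var_0)
  next
    case (pCons a p)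
    have "[:s c a:] = pscale s c [:a:]" "pCons 0 (pscale s c q) = pscale s c (pCons 0 q)" for q
      using module.scale_zero_right[OF assms] by (simp_all add: pscale_pCons[OF assms])
    with pCons show ?case
      by (simp only: pscale_pCons[OF assms, of c a p] flip_var_pCons[OF assms] der_def
          P.scale_right_diff_distrib P.scale_left_commute)
  qed
qed

lemma flip_var_shift:
  assumes "module s"
  shows "flip_var s (pCons 0 p) = - pCons 0 (flip_var s p) - der (pscale s) (flip_var s p)"
  using flip_var_pCons[OF assms, of 0 p] by simp

lemma flip_var_minus: "module s \<Longrightarrow> flip_var s (- p) = - flip_var s p"
  using additive.minus[of "flip_var s"] by (simp add: additive_def flip_var_add)

text \<open>
  Since \<open>\<partial>\<close> commutes with the substitution, \<open>\<lambda>\<close> is sent to \<open>-\<lambda>-\<partial>\<close> and then to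
  \<open>-(-\<lambda>-\<partial>)-\<partial> = \<lambda>\<close>.
\<close>

lemma flip_var_flip_var:
  assumes "module s"
  shows "flip_var s (flip_var s p) = p"
proof (induction p)
  case 0
  then show ?case by (simp add: flip_var_0)
next
  case (pCons a p)
  let ?q = "flip_var s p"
  have "flip_var s (pCons a p) = [:a:] + - pCons 0 ?q + - der (pscale s) ?q"
    by (simp only: flip_var_pCons[OF assms] diff_conv_add_uminus)
  then have "flip_var s (flip_var s (pCons a p)) =
      [:a:] + - (- pCons 0 p - der (pscale s) p) + - der (pscale s) p"
    using pCons
    by (simp only: flip_var_add[OF assms] flip_var_minus[OF assms] flip_var_const[OF assms]
        flip_var_shift[OF assms] der_def flip_var_pscale[OF assms])
  also have "\<dots> = pCons a p"
    by (intro poly_eqI) (simp add: coeff_pCons split: nat.split)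
  finally show ?case .
qed

section \<open>Conformal bilinear maps\<close>

lemma conf_bilinear_iff:
  assumes "module sU" "module sV" "module sW"
  shows "conf_bilinear sU sV sW f \<longleftrightarrow>
     (\<forall>a a' b. f (a + a') b = f a b + f a' b) \<and>
     (\<forall>a b b'. f a (b + b') = f a b + f a b') \<and>
     (\<forall>c a b. f (sU [:c:] a) b = pscale sW [:c:] (f a b)) \<and>
     (\<forall>c a b. f a (sV [:c:] b) = pscale sW [:c:] (f a b)) \<and>
     (\<forall>a b. f (der sU a) b = - pCons 0 (f a b)) \<and>
     (\<forall>a b. f a (der sV b) = pCons 0 (f a b) + der (pscale sW) (f a b))"
  using assms
  by (auto simp: conf_bilinear_def Vector_Spaces.linear_iff vector_space_cscale module_pscale)
    (simp_all add: cscale_def)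

lemma conf_bilinear_additive:
  assumes "conf_bilinear sU sV sW f"
  shows "additive (f a)" "additive (\<lambda>a. f a b)"
  using assms by (simp_all only: additive_def conf_bilinear_def Vector_Spaces.linear_iff) simp_all

lemma conf_bilinear_zero:
  assumes "conf_bilinear sU sV sW f"
  shows "f 0 b = 0" "f a 0 = 0"
  using conf_bilinear_additive[OF assms, THEN additive.zero] by simp_all

text \<open>
  Substituting \<open>-\<lambda>-\<partial>\<close> for \<open>\<lambda>\<close> turns the factor \<open>-\<lambda>\<close> into \<open>\<lambda> + \<partial>\<close> and conversely, so the two
  arguments exchange their roles.
\<close>

lemma conf_bilinear_flip_var:
  assumes "module sU" "module sV" "module sW" "conf_bilinear sU sV sW f"
  shows "conf_bilinear sV sU sW (\<lambda>b a. flip_var sW (f a b))"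
proof -
  interpret P: module "pscale sW" by (rule module_pscale) fact
  show ?thesis
    using assms
    by (auto simp: conf_bilinear_iff flip_var_add flip_var_pscale flip_var_minus flip_var_shift
        der_def)
qed

text \<open>
  With inclusions for \<open>i\<close>, \<open>j\<close> and a projection for \<open>h\<close>, this yields the components of a product on a
  direct sum.
\<close>

lemma conf_bilinear_compose:
  assumes i: "module_hom sU' sU i" and j: "module_hom sV' sV j" and h: "module_hom sW sW' h"
    and f: "conf_bilinear sU sV sW f"
  shows "conf_bilinear sU' sV' sW' (\<lambda>a b. map_poly h (f (i a) (j b)))"
proof -
  have mods: "module sU" "module sV" "module sW" "module sU'" "module sV'" "module sW'"
    using i j h by (simp_all add: module_hom_iff)
  have hs: "additive h" "h 0 = 0"
    using module_hom_additive[OF h] additive.zero by blast+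
  have ij: "i (sU' c a) = sU c (i a)" "i (a + a') = i a + i a'"
      "j (sV' c b) = sV c (j b)" "j (b + b') = j b + j b'" for a a' b b' c
    using i j by (simp_all add: module_hom_iff)
  have "map_poly h (- p) = - map_poly h p" for p
    by (intro poly_eqI) (simp add: coeff_map_poly hs additive.minus)
  with f show ?thesis
    unfolding conf_bilinear_iff[OF mods(1-3)] conf_bilinear_iff[OF mods(4-6)]
    by (simp add: ij der_def map_poly_add[OF hs(1)] map_poly_pscale[OF h] map_poly_shift hs(2))
qed

lemma cend_scale_0:
  assumes "module s"
  shows "cend_scale s 0 f = 0"
proof -
  interpret P: module "pscale s" by (rule module_pscale[OF assms])
  show ?thesis
    by (rule ext) (simp add: cend_scale_def poly_subst_0 cscale_def)
qed

lemma cend_scale_pCons: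
  assumes "module s"
  shows "cend_scale s (pCons c p) f v = pscale s [:c:] (f v) - pCons 0 (cend_scale s p f v)"
proof -
  interpret P: module "pscale s" by (rule module_pscale[OF assms])
  have "additive (\<lambda>q. - pCons 0 q :: 'a poly)"
    by (simp add: additive_def)
  then show ?thesis
    by (simp add: cend_scale_def poly_subst_pCons cscale_def)
qed

text \<open>
  A homomorphism into \<open>Cend(V)\<close> presupposes that its target is a module, and the target here is the
  space of all functions \<open>V \<rightarrow> V[\<lambda>]\<close>: the action of \<open>p(\<partial>)\<close> by \<open>p(-\<lambda>)\<close> makes sense for each of them.
\<close>

lemma module_cend_scale:
  assumes "module s"
  shows "module (cend_scale s)"
proof -
  interpret s: module s by (fact assms)
  interpret P: module "pscale s" by (rule module_pscale[OF assms])
  note rules = cend_scale_0[OF assms] cend_scale_pCons[OF assms]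
  have add_fun: "cend_scale s p (f + g) v = cend_scale s p f v + cend_scale s p g v" for p f g v
    by (induction p) (simp_all add: rules P.scale_right_distrib)
  have add_poly: "cend_scale s (p + q) f v = cend_scale s p f v + cend_scale s q f v" for p q f v
  proof (induction p q rule: poly_induct2)
    case (pCons a p b q)
    have "pscale s [:a + b:] w - pCons 0 (x + y) =
        (pscale s [:a:] w - pCons 0 x) + (pscale s [:b:] w - pCons 0 y)" for w x y
      using P.scale_left_distrib[of "[:a:]" "[:b:]" w] by (simp add: algebra_simps)
    with pCons show ?case
      by (simp only: add_pCons rules)
  qed (simp add: rules)
  have smult: "cend_scale s (smult c q) f v = pscale s [:c:] (cend_scale s q f v)" for c q f v
  proof (induction q)
    case (pCons a q)
    then show ?case
      by (simp add: rules P.scale_right_diff_distrib pscale_pCons[OF assms] mult.commute)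
  qed (simp add: rules)
  have mult: "cend_scale s p (cend_scale s q f) v = cend_scale s (p * q) f v" for p q f v
    by (induction p) (simp_all add: rules mult_pCons_left add_poly smult)
  have one: "cend_scale s 1 f v = f v" for f v
    by (simp add: one_pCons rules) (simp add: one_pCons[symmetric])
  show ?thesis
    by unfold_locales (auto simp: fun_eq_iff add_fun add_poly mult one)
qed

text \<open>
  Currying: the action of \<open>\<partial>\<close> on \<open>Cend(V)\<close> as \<open>-\<lambda>\<close> is sesquilinearity in the first argument, and
  membership in \<open>Cend(V)\<close> is sesquilinearity in the second. Linearity over all of \<open>\<complex>[\<partial>]\<close>
  follows from linearity over \<open>\<complex>\<close> and compatibility with \<open>\<partial>\<close> by Horner's rule.
\<close>

lemma hom_to_Cend_iff_conf_bilinear: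
  assumes U: "module sU" and V: "module sV"
  shows "hom_to_Cend sU sV F \<longleftrightarrow> conf_bilinear sU sV sV F"
proof
  assume F: "hom_to_Cend sU sV F"
  interpret V: module "pscale sV" by (rule module_pscale[OF V])
  have add: "F (a + a') = F a + F a'" and scale: "F (sU p a) = cend_scale sV p (F a)" for p a a'
    using F by (auto simp: hom_to_Cend_def module_hom_iff)
  have "conf_linear sV sV (F a)" for a
    using F by (auto simp: hom_to_Cend_def Cend_def)
  moreover have "cend_scale sV 1 (F a) = F a" for a
    by (rule module.scale_one[OF module_cend_scale[OF V]])
  ultimately show "conf_bilinear sU sV sV F"
    unfolding conf_bilinear_iff[OF U V V]
    by (simp add: conf_linear_def Vector_Spaces.linear_iff cscale_def add scale der_def
        cend_scale_pCons[OF V] cend_scale_0[OF V] one_pCons[symmetric])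
next
  assume F: "conf_bilinear sU sV sV F"
  interpret U: module sU by (rule U)
  interpret V: module "pscale sV" by (rule module_pscale[OF V])
  note F' = F[unfolded conf_bilinear_iff[OF U V V]]
  have "F (sU p a) v = cend_scale sV p (F a) v" for p a v
  proof (induction p)
    case 0
    show ?case
      using conf_bilinear_zero[OF F] by (simp add: cend_scale_0[OF V])
  next
    case (pCons c p)
    have "sU (pCons c p) a = sU [:c:] a + der sU (sU p a)"
      by (simp add: der_def U.scale_left_distrib[symmetric])
    with F' pCons show ?case
      by (simp add: cend_scale_pCons[OF V])
  qed
  with F' have "module_hom sU (cend_scale sV) F"
    by (simp add: module_hom_iff U module_cend_scale[OF V] fun_eq_iff)
  moreover from F have "range F \<subseteq> Cend sV"
    by (auto simp: Cend_def conf_linear_def conf_bilinear_def add.commute)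
  ultimately show "hom_to_Cend sU sV F"
    by (simp add: hom_to_Cend_def)
qed

lemma left_symm_conf_alg_bilinear: "left_symm_conf_alg s m \<Longrightarrow> conf_bilinear s s s m"
  by (simp only: left_symm_conf_alg_def)

section \<open>Polynomials over a direct sum\<close>

definition pair_poly :: "'r::ab_group_add poly \<Rightarrow> 'q::ab_group_add poly \<Rightarrow> ('r \<times> 'q) poly" where
  "pair_poly p q = map_poly (\<lambda>c. (c, 0)) p + map_poly (\<lambda>z. (0, z)) q"

lemma coeff_pair_poly: "coeff (pair_poly p q) i = (coeff p i, coeff q i)"
  by (simp add: pair_poly_def coeff_map_poly flip: zero_prod_def)

lemma pair_poly_eq_iff: "pair_poly p q = pair_poly p' q' \<longleftrightarrow> p = p' \<and> q = q'"
  by (auto simp: poly_eq_iff coeff_pair_poly)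

lemma pair_poly_add: "pair_poly p q + pair_poly p' q' = pair_poly (p + p') (q + q')"
  by (intro poly_eqI) (simp add: coeff_pair_poly)

lemma pair_poly_fst_snd: "pair_poly (map_poly fst P) (map_poly snd P) = P"
  by (intro poly_eqI) (simp add: coeff_pair_poly coeff_map_poly)

lemma map_poly_inl: "map_poly (\<lambda>c. (c, 0)) p = pair_poly p 0"
  by (simp add: pair_poly_def)

lemma unified_prod_eq:
  "unified_prod sR sQ mR \<Omega> (a, x) (b, y) =
    pair_poly (mR a b + phi \<Omega> x b + flip_var sR (psi \<Omega> y a) + gmap \<Omega> x y)
      (circ \<Omega> x y + lact \<Omega> a y + flip_var sQ (ract \<Omega> b x))"
  by (simp add: unified_prod_def pair_poly_def)

lemma biadditive_split:
  fixes m :: "'r::ab_group_add \<times> 'q::ab_group_add \<Rightarrow> 'r \<times> 'q \<Rightarrow> 'w::ab_group_add"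
  assumes "\<And>p. additive (m p)" "\<And>q. additive (\<lambda>p. m p q)"
  shows "m (a, x) (b, y) = m (a, 0) (b, 0) + m (a, 0) (0, y) + m (0, x) (b, 0) + m (0, x) (0, y)"
proof -
  have "m (a, x) (b, y) = m ((a, 0) + (0, x)) ((b, 0) + (0, y))"
    by simp
  also have "\<dots> = m (a, 0) (b, 0) + m (a, 0) (0, y) + m (0, x) (b, 0) + m (0, x) (0, y)"
    by (simp only: additive.add[OF assms(1)] additive.add[OF assms(2)] add_ac)
  finally show ?thesis .
qed

lemma biadditive_eqI:
  fixes m m' :: "'r::ab_group_add \<times> 'q::ab_group_add \<Rightarrow> 'r \<times> 'q \<Rightarrow> 'w::ab_group_add"
  assumes "\<And>p. additive (m p)" "\<And>q. additive (\<lambda>p. m p q)"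
    and "\<And>p. additive (m' p)" "\<And>q. additive (\<lambda>p. m' p q)"
    and "\<And>a b. m (a, 0) (b, 0) = m' (a, 0) (b, 0)" "\<And>a y. m (a, 0) (0, y) = m' (a, 0) (0, y)"
    and "\<And>x b. m (0, x) (b, 0) = m' (0, x) (b, 0)" "\<And>x y. m (0, x) (0, y) = m' (0, x) (0, y)"
  shows "m p q = m' p q"
proof -
  obtain a x b y where "p = (a, x)" "q = (b, y)"
    by fastforce
  then show ?thesis
    by (simp only: biadditive_split[of m a x b y, OF assms(1,2)]
        biadditive_split[of m' a x b y, OF assms(3,4)] assms(5-))
qed

section \<open>Maps of the direct sum that stabilize the first summand\<close>

text \<open>
  For homomorphisms \<open>u\<close> and \<open>v\<close>, the block triangular endomorphism of \<open>R \<oplus> Q\<close> with diagonal blocks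
  \<open>id\<close> and \<open>v\<close>.
\<close>

definition shear :: "('q \<Rightarrow> 'r::ab_group_add) \<Rightarrow> ('q \<Rightarrow> 'q) \<Rightarrow> 'r \<times> 'q \<Rightarrow> 'r \<times> 'q" where
  "shear u v = (\<lambda>(a, x). (a + u x, v x))"

lemma map_poly_shear:
  assumes "u 0 = 0" "v 0 = 0"
  shows "map_poly (shear u v) (pair_poly p q) = pair_poly (p + map_poly u q) (map_poly v q)"
  by (intro poly_eqI)
    (simp add: coeff_pair_poly coeff_map_poly shear_def assms zero_prod_def)

lemma bij_shear_iff: "bij (shear u v) \<longleftrightarrow> bij v"
proof
  assume bij: "bij (shear u v)"
  have "inj v"
  proof (rule injI)
    fix x y
    assume "v x = v y"
    \<comment> \<open>The first coordinates are chosen so that those of the images vanish.\<close>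
    then have "shear u v (- u x, x) = shear u v (- u y, y)"
      by (simp add: shear_def)
    then show "x = y"
      using bij by (auto simp: bij_def inj_eq)
  qed
  moreover have "surj v"
  proof (rule surjI)
    show "v (snd (inv (shear u v) (0, y))) = y" for y
      using surj_f_inv_f[OF bij_is_surj[OF bij], of "(0, y)"]
      by (simp add: shear_def split: prod.splits)
  qed
  ultimately show "bij v"
    by (simp add: bij_def)
next
  assume bij: "bij v"
  show "bij (shear u v)"
  proof (rule o_bij)
    let ?w = "\<lambda>(a, y). (a - u (inv v y), inv v y)"
    show "?w \<circ> shear u v = id" "shear u v \<circ> ?w = id"
      using bij by (auto simp: shear_def bij_def surj_f_inv_f)
  qed
qed

lemma co_stabilizes_shear_iff: "co_stabilizes (shear u v) \<longleftrightarrow> v = id"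
  by (auto simp: co_stabilizes_def shear_def fun_eq_iff)

lemma module_sum_scale:
  assumes "module sR" "module sQ"
  shows "module (sum_scale sR sQ)"
proof -
  interpret R: module sR by fact
  interpret Q: module sQ by fact
  show ?thesis
    by unfold_locales
      (auto simp: sum_scale_def R.scale_right_distrib R.scale_left_distrib Q.scale_right_distrib
        Q.scale_left_distrib)
qed

text \<open>
  Additivity gives \<open>f (a, x) = f (a, 0) + f (0, x)\<close>; the first summand is \<open>(a, 0)\<close>, and the
  components of the second are \<open>u x\<close> and \<open>v x\<close>.
\<close>

lemma stabilizes_hom_iff_shear:
  assumes R: "module sR" and Q: "module sQ"
  shows "module_hom (sum_scale sR sQ) (sum_scale sR sQ) f \<and> stabilizes f \<longleftrightarrow>
    (\<exists>u v. module_hom sQ sR u \<and> module_hom sQ sQ v \<and> f = shear u v)"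
proof
  assume f: "module_hom (sum_scale sR sQ) (sum_scale sR sQ) f \<and> stabilizes f"
  let ?u = "\<lambda>x. fst (f (0, x))" and ?v = "\<lambda>x. snd (f (0, x))"
  have add: "f (p + q) = f p + f q" and scale: "f (sum_scale sR sQ c p) = sum_scale sR sQ c (f p)"
    for p q c
    using f by (simp_all add: module_hom_iff del: split_paired_All)
  have "f (0, x + y) = f (0, x) + f (0, y)" for x y
    using add[of "(0, x)" "(0, y)"] by simp
  moreover have "f (0, sQ c x) = sum_scale sR sQ c (f (0, x))" for c x
    using scale[of c "(0, x)"] module.scale_zero_right[OF R] by (simp add: sum_scale_def)
  ultimately have "module_hom sQ sR ?u" "module_hom sQ sQ ?v"
    by (simp_all add: module_hom_iff R Q sum_scale_def split: prod.split)
  moreover have "f = shear ?u ?v"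
  proof (rule ext, clarify)
    show "f (a, x) = shear ?u ?v (a, x)" for a x
      using add[of "(a, 0)" "(0, x)"] f by (simp add: stabilizes_def shear_def prod_eq_iff)
  qed
  ultimately show "\<exists>u v. module_hom sQ sR u \<and> module_hom sQ sQ v \<and> f = shear u v"
    by blast
next
  assume "\<exists>u v. module_hom sQ sR u \<and> module_hom sQ sQ v \<and> f = shear u v"
  then obtain u v where u: "module_hom sQ sR u" and v: "module_hom sQ sQ v"
    and f: "f = shear u v"
    by blast
  have "u 0 = 0" "v 0 = 0"
    using additive.zero[OF module_hom_additive[OF u]] additive.zero[OF module_hom_additive[OF v]] .
  moreover have "module_hom (sum_scale sR sQ) (sum_scale sR sQ) f"
    using u v by (auto simp: module_hom_iff module_sum_scale f shear_def sum_scale_def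
        module.scale_right_distrib)
  ultimately show "module_hom (sum_scale sR sQ) (sum_scale sR sQ) f \<and> stabilizes f"
    by (simp add: f stabilizes_def shear_def)
qed

section \<open>Unified products and algebra structures\<close>

locale conf_extension =
  fixes sR :: "complex poly \<Rightarrow> 'r::ab_group_add \<Rightarrow> 'r"
    and sQ :: "complex poly \<Rightarrow> 'q::ab_group_add \<Rightarrow> 'q"
    and mR :: "'r \<Rightarrow> 'r \<Rightarrow> 'r poly"
  assumes R: "module sR" and Q: "module sQ" and mR: "conf_bilinear sR sR sR mR"
begin

abbreviation "sE \<equiv> sum_scale sR sQ"

abbreviation "nprod \<equiv> unified_prod sR sQ mR"

lemma extending_datum_iff:
  "extending_datum sR sQ \<Omega> \<longleftrightarrow>
    conf_bilinear sQ sR sR (phi \<Omega>) \<and> conf_bilinear sQ sR sR (psi \<Omega>) \<and>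
    conf_bilinear sR sQ sQ (lact \<Omega>) \<and> conf_bilinear sR sQ sQ (ract \<Omega>) \<and>
    conf_bilinear sQ sQ sR (gmap \<Omega>) \<and> conf_bilinear sQ sQ sQ (circ \<Omega>)"
  by (simp add: extending_datum_def hom_to_Cend_iff_conf_bilinear R Q)

lemma datum_zero:
  assumes "extending_datum sR sQ \<Omega>"
  shows "phi \<Omega> 0 b = 0" "phi \<Omega> x 0 = 0" "psi \<Omega> 0 b = 0" "psi \<Omega> x 0 = 0"
    "lact \<Omega> 0 y = 0" "lact \<Omega> a 0 = 0" "ract \<Omega> 0 y = 0" "ract \<Omega> a 0 = 0"
    "gmap \<Omega> 0 y = 0" "gmap \<Omega> x 0 = 0" "circ \<Omega> 0 y = 0" "circ \<Omega> x 0 = 0"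
    "mR 0 b = 0" "mR a 0 = 0"
  using assms mR unfolding extending_datum_iff
  by (auto dest: conf_bilinear_zero)

lemma unified_prod_in_alg_structures:
  assumes "\<Omega> \<in> extending_structures sR sQ mR"
  shows "nprod \<Omega> \<in> alg_structures sR sQ mR"
  using assms
  by (auto simp: extending_structures_def alg_structures_def unified_prod_eq datum_zero
      flip_var_0 map_poly_inl)

text \<open>
  The variable is flipped in \<open>psi\<close> and \<open>ract\<close> because the unified product evaluates these two at
  \<open>-\<lambda>-\<partial>\<close>, with their arguments in the opposite order.
\<close>

definition datum_of :: "('r \<times> 'q \<Rightarrow> 'r \<times> 'q \<Rightarrow> ('r \<times> 'q) poly) \<Rightarrow> ('r, 'q) ext_datum" where
  "datum_of m = \<lparr>
     phi = (\<lambda>x b. map_poly fst (m (0, x) (b, 0))),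
     psi = (\<lambda>y a. flip_var sR (map_poly fst (m (a, 0) (0, y)))),
     lact = (\<lambda>a y. map_poly snd (m (a, 0) (0, y))),
     ract = (\<lambda>b x. flip_var sQ (map_poly snd (m (0, x) (b, 0)))),
     gmap = (\<lambda>x y. map_poly fst (m (0, x) (0, y))),
     circ = (\<lambda>x y. map_poly snd (m (0, x) (0, y)))\<rparr>"

lemma extending_datum_datum_of:
  assumes m: "conf_bilinear sE sE sE m"
  shows "extending_datum sR sQ (datum_of m)"
proof -
  have inl: "module_hom sR sE (\<lambda>a. (a, 0))" and inr: "module_hom sQ sE (\<lambda>x. (0, x))"
    and fst: "module_hom sE sR fst" and snd: "module_hom sE sQ snd"
    using module.scale_zero_right[OF R] module.scale_zero_right[OF Q]
    by (auto simp: module_hom_iff R Q module_sum_scale sum_scale_def)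
  note comp = conf_bilinear_compose[OF _ _ _ m]
  show ?thesis
    unfolding extending_datum_iff datum_of_def ext_datum.simps
    by (intro conjI comp[OF inr inl fst] comp[OF inl inr snd] comp[OF inr inr fst]
        comp[OF inr inr snd] conf_bilinear_flip_var[OF R Q R comp[OF inl inr fst]]
        conf_bilinear_flip_var[OF Q R Q comp[OF inr inl snd]])
qed

lemma unified_prod_datum_of:
  assumes "m \<in> alg_structures sR sQ mR"
  shows "nprod (datum_of m) = m"
proof (intro ext, clarify)
  fix a x b y
  have m: "conf_bilinear sE sE sE m"
    and mR_eq: "m (a, 0) (b, 0) = pair_poly (mR a b) 0" for a b
    using assms by (simp_all add: alg_structures_def left_symm_conf_alg_def map_poly_inl)
  have "m (a, x) (b, y) = pair_poly (mR a b) 0 + m (a, 0) (0, y) + m (0, x) (b, 0) + m (0, x) (0, y)"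
    using biadditive_split[of m a x b y, OF conf_bilinear_additive[OF m]] by (simp only: mR_eq)
  also have "\<dots> = pair_poly (mR a b) 0
      + pair_poly (map_poly fst (m (a, 0) (0, y))) (map_poly snd (m (a, 0) (0, y)))
      + pair_poly (map_poly fst (m (0, x) (b, 0))) (map_poly snd (m (0, x) (b, 0)))
      + pair_poly (map_poly fst (m (0, x) (0, y))) (map_poly snd (m (0, x) (0, y)))"
    by (simp only: pair_poly_fst_snd)
  also have "\<dots> = nprod (datum_of m) (a, x) (b, y)"
    by (simp add: unified_prod_eq datum_of_def flip_var_flip_var R Q pair_poly_add ac_simps)
  finally show "nprod (datum_of m) (a, x) (b, y) = m (a, x) (b, y)"
    by simp
qed

text \<open>
  The components of a structure that contains \<open>R\<close> have that structure as their unified product, so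
  left symmetry of the unified product is immediate.
\<close>

lemma unified_prod_image: "nprod ` extending_structures sR sQ mR = alg_structures sR sQ mR"
proof (intro equalityI subsetI)
  fix m
  assume m: "m \<in> alg_structures sR sQ mR"
  then have "left_symm_conf_alg sE m" "conf_bilinear sE sE sE m"
    by (simp_all add: alg_structures_def left_symm_conf_alg_def)
  then have "datum_of m \<in> extending_structures sR sQ mR"
    by (simp add: extending_structures_def extending_datum_datum_of unified_prod_datum_of[OF m])
  then show "m \<in> nprod ` extending_structures sR sQ mR"
    using unified_prod_datum_of[OF m] by (metis imageI)
qed (auto intro: unified_prod_in_alg_structures)

text \<open>
  Both sides of the homomorphism condition are biadditive, so it may be tested on the blocks. On
  \<open>R \<times> R\<close> it holds because both products extend that of \<open>R\<close>; on \<open>R \<times> Q\<close>, \<open>Q \<times> R\<close> and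
  \<open>Q \<times> Q\<close> the \<open>R\<close>- and \<open>Q\<close>-components are the six equations of compatibility.
\<close>

lemma shear_hom_iff_compatible:
  assumes \<Omega>: "\<Omega> \<in> extending_structures sR sQ mR" and \<Omega>': "\<Omega>' \<in> extending_structures sR sQ mR"
    and u: "module_hom sQ sR u" and v: "module_hom sQ sQ v"
  shows "lsca_hom sE (nprod \<Omega>) sE (nprod \<Omega>') (shear u v) \<longleftrightarrow> ext_compatible sR sQ mR \<Omega> \<Omega>' u v"
proof -
  let ?f = "shear u v" and ?m = "nprod \<Omega>" and ?m' = "nprod \<Omega>'"
  let ?eq = "\<lambda>p q. map_poly ?f (?m p q) = ?m' (?f p) (?f q)"
  have uv: "u 0 = 0" "v 0 = 0"
    using additive.zero[OF module_hom_additive[OF u]] additive.zero[OF module_hom_additive[OF v]] .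
  have f: "module_hom sE sE ?f"
    using stabilizes_hom_iff_shear[OF R Q] u v by blast
  note f_add = module_hom_additive[OF f]
  have d: "extending_datum sR sQ \<Omega>" "extending_datum sR sQ \<Omega>'"
    and m: "conf_bilinear sE sE sE ?m" "conf_bilinear sE sE sE ?m'"
    using \<Omega> \<Omega>' left_symm_conf_alg_bilinear by (auto simp: extending_structures_def)
  note zero = datum_zero[OF d(1)] datum_zero[OF d(2)] flip_var_0 uv
  note add = conf_bilinear_additive[OF m(1)] conf_bilinear_additive[OF m(2)]
  have "(\<forall>p q. ?eq p q) \<longleftrightarrow> (\<forall>a b. ?eq (a, 0) (b, 0)) \<and> (\<forall>a x. ?eq (a, 0) (0, x)) \<and>
      (\<forall>a x. ?eq (0, x) (a, 0)) \<and> (\<forall>x y. ?eq (0, x) (0, y))" (is "?L \<longleftrightarrow> ?R")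
  proof
    assume blocks: ?R
    have "?eq p q" for p q
    proof (rule biadditive_eqI[of "\<lambda>p q. map_poly ?f (?m p q)" "\<lambda>p q. ?m' (?f p) (?f q)"])
      show "additive (\<lambda>q. map_poly ?f (?m p q))" "additive (\<lambda>q. ?m' (?f p) (?f q))" for p
        using add f_add by (simp_all add: additive_def map_poly_add[OF f_add] del: split_paired_All)
      show "additive (\<lambda>p. map_poly ?f (?m p q))" "additive (\<lambda>p. ?m' (?f p) (?f q))" for q
        using add f_add by (simp_all add: additive_def map_poly_add[OF f_add] del: split_paired_All)
    qed (use blocks in auto)
    then show ?L by blast
  qed blast
  moreover have "?eq (a, 0) (b, 0)" for a b
    by (simp add: unified_prod_eq zero map_poly_shear)
      (simp add: shear_def unified_prod_eq zero)
  moreover have "?eq (a, 0) (0, x) \<longleftrightarrow>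
      flip_var sR (psi \<Omega> x a) + map_poly u (lact \<Omega> a x) = mR a (u x) + flip_var sR (psi \<Omega>' (v x) a)
      \<and> map_poly v (lact \<Omega> a x) = lact \<Omega>' a (v x)" for a x
    by (simp add: unified_prod_eq zero map_poly_shear)
      (simp add: shear_def unified_prod_eq zero pair_poly_eq_iff)
  moreover have "?eq (0, x) (a, 0) \<longleftrightarrow>
      phi \<Omega> x a + map_poly u (flip_var sQ (ract \<Omega> a x)) = mR (u x) a + phi \<Omega>' (v x) a
      \<and> map_poly v (flip_var sQ (ract \<Omega> a x)) = flip_var sQ (ract \<Omega>' a (v x))" for a x
    by (simp add: unified_prod_eq zero map_poly_shear)
      (simp add: shear_def unified_prod_eq zero pair_poly_eq_iff)
  moreover have "?eq (0, x) (0, y) \<longleftrightarrow>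
      gmap \<Omega> x y + map_poly u (circ \<Omega> x y) = mR (u x) (u y) + phi \<Omega>' (v x) (u y)
        + flip_var sR (psi \<Omega>' (v y) (u x)) + gmap \<Omega>' (v x) (v y)
      \<and> map_poly v (circ \<Omega> x y) = flip_var sQ (ract \<Omega>' (u y) (v x)) + lact \<Omega>' (u x) (v y)
        + circ \<Omega>' (v x) (v y)" for x y
    by (simp add: unified_prod_eq zero map_poly_shear)
      (simp add: shear_def unified_prod_eq zero pair_poly_eq_iff ac_simps)
  ultimately show ?thesis
    unfolding lsca_hom_def ext_compatible_def using f by (simp only:) blast
qed

lemma ext_equiv_iff_alg_equiv:
  assumes "\<Omega> \<in> extending_structures sR sQ mR" "\<Omega>' \<in> extending_structures sR sQ mR"
  shows "(\<Omega>, \<Omega>') \<in> ext_equiv sR sQ mR \<longleftrightarrow> (nprod \<Omega>, nprod \<Omega>') \<in> alg_equiv sR sQ mR"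
    and "(\<Omega>, \<Omega>') \<in> ext_equiv_id sR sQ mR \<longleftrightarrow> (nprod \<Omega>, nprod \<Omega>') \<in> alg_equiv_co sR sQ mR"
proof -
  have iso: "lsca_iso sE (nprod \<Omega>) sE (nprod \<Omega>') f \<and> stabilizes f \<longleftrightarrow>
      (\<exists>u v. module_hom sQ sR u \<and> module_hom sQ sQ v \<and> f = shear u v \<and> bij v \<and>
        ext_compatible sR sQ mR \<Omega> \<Omega>' u v)" (is "?L f \<longleftrightarrow> ?R f") for f
  proof
    assume L: "?L f"
    then obtain u v where uv: "module_hom sQ sR u" "module_hom sQ sQ v" "f = shear u v"
      using stabilizes_hom_iff_shear[OF R Q, of f] by (auto simp: lsca_iso_def lsca_hom_def)
    with L shear_hom_iff_compatible[OF assms uv(1,2)] show "?R f"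
      by (auto simp: lsca_iso_def bij_shear_iff)
  next
    assume "?R f"
    then obtain u v where uv: "module_hom sQ sR u" "module_hom sQ sQ v" "f = shear u v"
        "bij v" "ext_compatible sR sQ mR \<Omega> \<Omega>' u v"
      by blast
    then have "stabilizes f"
      using stabilizes_hom_iff_shear[OF R Q, of f] by blast
    with uv shear_hom_iff_compatible[OF assms uv(1,2)] show "?L f"
      by (simp add: lsca_iso_def bij_shear_iff)
  qed
  show "(\<Omega>, \<Omega>') \<in> ext_equiv sR sQ mR \<longleftrightarrow> (nprod \<Omega>, nprod \<Omega>') \<in> alg_equiv sR sQ mR"
    by (simp add: ext_equiv_def alg_equiv_def assms unified_prod_in_alg_structures iso) blast
  have "(\<exists>f. (lsca_iso sE (nprod \<Omega>) sE (nprod \<Omega>') f \<and> stabilizes f) \<and> co_stabilizes f) \<longleftrightarrow>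
      (\<exists>u. module_hom sQ sR u \<and> ext_compatible sR sQ mR \<Omega> \<Omega>' u id)"
    unfolding iso using module.module_hom_id[OF Q] co_stabilizes_shear_iff by auto
  then show "(\<Omega>, \<Omega>') \<in> ext_equiv_id sR sQ mR \<longleftrightarrow> (nprod \<Omega>, nprod \<Omega>') \<in> alg_equiv_co sR sQ mR"
    by (simp add: ext_equiv_id_def alg_equiv_co_def assms unified_prod_in_alg_structures conj_assoc)
qed

end

section \<open>Equivalence relations and quotients\<close>

lemma lsca_iso_id: "module s \<Longrightarrow> lsca_iso s m s m id"
  by (simp add: lsca_iso_def lsca_hom_def module.module_hom_id)

lemma lsca_iso_inv:
  assumes "lsca_iso s m s' m' f"
  shows "lsca_iso s' m' s m (inv f)"
proof -
  have f: "module_hom s s' f" "bij f" and hom: "map_poly f (m a b) = m' (f a) (f b)" for a b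
    using assms by (auto simp: lsca_iso_def lsca_hom_def)
  have f0: "f 0 = 0"
    by (rule additive.zero[OF module_hom_additive[OF f(1)]])
  note inv_eq = inv_f_eq[OF bij_is_inj[OF f(2)]] surj_f_inv_f[OF bij_is_surj[OF f(2)]]
  have inv0: "inv f 0 = 0"
    by (rule inv_eq(1)[OF f0])
  have "inv f (x + y) = inv f x + inv f y" "inv f (s' c x) = s c (inv f x)" for x y c
    using f(1) by (auto simp: module_hom_iff inv_eq(2) intro!: inv_eq(1))
  then have "module_hom s' s (inv f)"
    using f(1) by (simp add: module_hom_iff)
  moreover have "map_poly (inv f) (m' a b) = m (inv f a) (inv f b)" for a b
  proof -
    have "map_poly (inv f) (m' a b) = map_poly (inv f) (map_poly f (m (inv f a) (inv f b)))"
      by (simp add: hom surj_f_inv_f bij_is_surj[OF f(2)])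
    also have "\<dots> = m (inv f a) (inv f b)"
      by (simp add: map_poly_map_poly f0 inv0 inv_o_cancel bij_is_inj[OF f(2)])
    finally show ?thesis .
  qed
  ultimately show ?thesis
    by (simp add: lsca_iso_def lsca_hom_def f(2) bij_imp_bij_inv)
qed

lemma lsca_iso_compose:
  assumes "lsca_iso s m s' m' f" "lsca_iso s' m' s'' m'' g"
  shows "lsca_iso s m s'' m'' (g \<circ> f)"
proof -
  have "f 0 = 0" "g 0 = 0"
    using assms additive.zero[OF module_hom_additive] by (auto simp: lsca_iso_def lsca_hom_def)
  then show ?thesis
    using assms
    by (auto simp: lsca_iso_def lsca_hom_def module_hom_iff bij_comp map_poly_map_poly[symmetric])
qed

lemma stabilizes_inv: "bij f \<Longrightarrow> stabilizes f \<Longrightarrow> stabilizes (inv f)"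
  by (simp add: stabilizes_def inv_f_eq[OF bij_is_inj])

lemma co_stabilizes_inv: "bij f \<Longrightarrow> co_stabilizes f \<Longrightarrow> co_stabilizes (inv f)"
  unfolding co_stabilizes_def by (metis bij_is_surj comp_assoc comp_id surj_iff)

lemma equiv_alg_structures:
  "equiv (alg_structures sR sQ mR) (alg_equiv sR sQ mR)"
  "equiv (alg_structures sR sQ mR) (alg_equiv_co sR sQ mR)"
proof -
  note iso = lsca_iso_id lsca_iso_inv lsca_iso_compose
  have st: "stabilizes id" "co_stabilizes id"
    "\<And>f g. stabilizes f \<Longrightarrow> stabilizes g \<Longrightarrow> stabilizes (g \<circ> f)"
    "\<And>f g. co_stabilizes f \<Longrightarrow> co_stabilizes g \<Longrightarrow> co_stabilizes (g \<circ> f)"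
    by (simp_all add: stabilizes_def co_stabilizes_def flip: comp_assoc)
  have mod: "module (sum_scale sR sQ)" if "m \<in> alg_structures sR sQ mR" for m
    using that by (simp add: alg_structures_def left_symm_conf_alg_def)
  show "equiv (alg_structures sR sQ mR) (alg_equiv sR sQ mR)"
  proof (rule equivI)
    show "refl_on (alg_structures sR sQ mR) (alg_equiv sR sQ mR)"
      unfolding refl_on_def alg_equiv_def using mod iso(1) st by blast
    show "sym (alg_equiv sR sQ mR)"
      unfolding sym_def alg_equiv_def using iso(2) stabilizes_inv lsca_iso_def by blast
    show "trans (alg_equiv sR sQ mR)"
      unfolding trans_def alg_equiv_def using iso(3) st(3) by blast
  qed (auto simp: alg_equiv_def)
  show "equiv (alg_structures sR sQ mR) (alg_equiv_co sR sQ mR)"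
  proof (rule equivI)
    show "refl_on (alg_structures sR sQ mR) (alg_equiv_co sR sQ mR)"
      unfolding refl_on_def alg_equiv_co_def using mod iso(1) st by blast
    show "sym (alg_equiv_co sR sQ mR)"
      unfolding sym_def alg_equiv_co_def
      using iso(2) stabilizes_inv co_stabilizes_inv lsca_iso_def by blast
    show "trans (alg_equiv_co sR sQ mR)"
      unfolding trans_def alg_equiv_co_def using iso(3) st(3,4) by blast
  qed (auto simp: alg_equiv_co_def)
qed

text \<open>
  On classes, \<open>h\<close> induces a surjective map because \<open>h\<close> is surjective, and a well-defined injective one
  because \<open>R\<close> is the preimage of \<open>S\<close>.
\<close>

lemma bij_betw_quotients:
  assumes S: "equiv B S" and R: "R \<subseteq> A \<times> A" and h: "h ` A = B"
    and iff: "\<And>x y. x \<in> A \<Longrightarrow> y \<in> A \<Longrightarrow> (x, y) \<in> R \<longleftrightarrow> (h x, h y) \<in> S"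
  shows "equiv A R" "\<exists>F. (\<forall>x\<in>A. F (R `` {x}) = S `` {h x}) \<and> bij_betw F (A // R) (B // S)"
proof -
  have S': "refl_on B S" "sym S" "trans S"
    using S by (auto elim: equivE)
  show R_equiv: "equiv A R"
  proof (rule equivI)
    show "refl_on A R"
      using S'(1) iff h by (auto simp: refl_on_def)
    show "sym R"
      using S'(2) iff R by (auto simp: sym_def)
    show "trans R"
      using S'(3) iff R unfolding trans_def by blast
  qed (fact R)
  define F where "F X = S `` (h ` X)" for X
  have F: "F (R `` {x}) = S `` {h x}" if x: "x \<in> A" for x
  proof -
    have "x \<in> R `` {x}" and "\<And>y. y \<in> R `` {x} \<Longrightarrow> (h x, h y) \<in> S"
      using x iff R equiv_class_self[OF R_equiv] by auto
    then show ?thesis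
      unfolding F_def using S'(3) by (auto dest: transD)
  qed
  have "bij_betw F (A // R) (B // S)"
  proof (rule bij_betw_imageI)
    show "inj_on F (A // R)"
    proof (rule inj_onI, elim quotientE)
      fix X Y x y
      assume "F X = F Y" and xy: "x \<in> A" "X = R `` {x}" "y \<in> A" "Y = R `` {y}"
      then have "(h x, h y) \<in> S"
        using F h eq_equiv_class_iff[OF S, of "h x" "h y"] by auto
      then show "X = Y"
        using xy iff eq_equiv_class_iff[OF R_equiv] by simp
    qed
    show "F ` (A // R) = B // S"
      using F by (auto simp: quotient_def simp flip: h)
  qed
  with F show "\<exists>F. (\<forall>x\<in>A. F (R `` {x}) = S `` {h x}) \<and> bij_betw F (A // R) (B // S)"
    by blast
qed

section \<open>Classification of the extensions\<close>

theorem theorem3p9: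
  fixes sR :: "complex poly \<Rightarrow> 'r::ab_group_add \<Rightarrow> 'r"
    and sQ :: "complex poly \<Rightarrow> 'q::ab_group_add \<Rightarrow> 'q"
    and mR :: "'r \<Rightarrow> 'r \<Rightarrow> 'r poly"
  assumes "left_symm_conf_alg sR mR"
    and "\<exists>a::'r. a \<noteq> 0"
    and "module sQ"
  shows
    "(equiv (extending_structures sR sQ mR) (ext_equiv sR sQ mR) \<and>
      equiv (alg_structures sR sQ mR) (alg_equiv sR sQ mR) \<and>
      (\<exists>F. (\<forall>\<Omega>\<in>extending_structures sR sQ mR.
              F (ext_equiv sR sQ mR `` {\<Omega>}) = alg_equiv sR sQ mR `` {unified_prod sR sQ mR \<Omega>}) \<and>
           bij_betw F (H2_R sR sQ mR) (CExtd sR sQ mR)))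
     \<and>
     (equiv (extending_structures sR sQ mR) (ext_equiv_id sR sQ mR) \<and>
      equiv (alg_structures sR sQ mR) (alg_equiv_co sR sQ mR) \<and>
      (\<exists>F. (\<forall>\<Omega>\<in>extending_structures sR sQ mR.
              F (ext_equiv_id sR sQ mR `` {\<Omega>}) = alg_equiv_co sR sQ mR `` {unified_prod sR sQ mR \<Omega>}) \<and>
           bij_betw F (H2 sR sQ mR) (CExtd' sR sQ mR)))"
proof -
  interpret conf_extension sR sQ mR
    using assms(1,3) left_symm_conf_alg_bilinear[OF assms(1)]
    by (simp add: conf_extension_def left_symm_conf_alg_def)
  let ?A = "extending_structures sR sQ mR"
  have "ext_equiv sR sQ mR \<subseteq> ?A \<times> ?A" "ext_equiv_id sR sQ mR \<subseteq> ?A \<times> ?A"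
    by (auto simp: ext_equiv_def ext_equiv_id_def)
  note quot = bij_betw_quotients[OF equiv_alg_structures(1) this(1) unified_prod_image
      ext_equiv_iff_alg_equiv(1)]
    bij_betw_quotients[OF equiv_alg_structures(2) this(2) unified_prod_image
      ext_equiv_iff_alg_equiv(2)]
  show ?thesis
    unfolding H2_R_def H2_def CExtd_def CExtd'_def
    by (intro conjI quot equiv_alg_structures)
qed

end
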